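(* Let $p>1$ and $1/p<d<1$. Let $\psi_j=(j+1)^{-d}$ for $j\ge0$ and $\psi_j=0$ for $j<0$. Then there is a positive constant $c$ such that $\mathcal W_n(p)\sim c\cdot n^{1/p+1-d}$ as $n\to\infty$.
   Context: For $n\ge1$ and $j\in\mathbb Z$, $w_{nj}=\sum_{k=1}^n\psi_{k-j}$ (with the convention $\psi_i=0$ for $i<0$), and for $p\ge1$, $$\mathcal W_n(p)=\Bigl(\sum_{j=-\infty}^n|w_{nj}|^p\Bigr)^{1/p}.$$ $a_n\sim b_n$ means $a_n/b_n\to1$ as $n\to\infty$. *)

theory Defs
  imports "HOL-Analysis.Infinite_Sum" "HOL-Library.Landau_Symbols"
begin

definition w :: "(int \<Rightarrow> real) \<Rightarrow> nat \<Rightarrow> int \<Rightarrow> real" where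
  "w \<psi> n j = (\<Sum>k=1..n. \<psi> (int k - j))"

(* If the family is not summable, infsum and hence W is 0.  This cannot satisfy an
   asymptotic equivalence with an eventually positive sequence. *)
definition W :: "(int \<Rightarrow> real) \<Rightarrow> real \<Rightarrow> nat \<Rightarrow> real" where
  "W \<psi> p n = (\<Sum>\<^sub>\<infinity>j\<in>{..int n}. \<bar>w \<psi> n j\<bar> powr p) powr (1 / p)"

end

theory Submission
  imports Defs "HOL-Analysis.Analysis"
begin

text \<open>
  Write \<open>P m\<close> for the sum of \<open>l powr (- d)\<close> over \<open>1 \<le> l \<le> m\<close>, so that \<open>P m = 0\<close> for
  \<open>m \<le> 0\<close>.  With \<open>j = n - i\<close>, the weight \<open>w \<psi> n j\<close> is the window \<open>P (i + 1) - P (i + 1 - n)\<close>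
  of this sum.  Hence the \<open>p\<close>-th power of \<open>W \<psi> p n\<close> is a sum over \<open>i \<ge> 0\<close>, that is, the
  integral of a step function.  Substituting \<open>i + 1 = \<lceil>n x\<rceil>\<close> and dividing each window by its
  natural size \<open>n powr (1 - d)\<close> turns it into \<open>n powr (1 + p (1 - d))\<close> times the integral of the
  \<open>p\<close>-th power of a profile function of \<open>x\<close> (\<open>W_eq_integral\<close>).

  Since \<open>P m\<close> is asymptotic to \<open>m powr (1 - d) / (1 - d)\<close>, the profiles converge pointwise to
  \<open>f x = (max x 0 powr (1 - d) - max (x - 1) 0 powr (1 - d)) / (1 - d)\<close>.  They vanish for
  \<open>x \<le> 0\<close> and are bounded by a constant for \<open>0 < x < 2\<close>.  For \<open>x \<ge> 2\<close> each of the \<open>n\<close> terms in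
  the window is at most \<open>(n (x - 1)) powr (- d)\<close>, so the profile is at most
  \<open>(x - 1) powr (- d)\<close>.  The \<open>p\<close>-th power of this tail is integrable because \<open>d p > 1\<close>.
  Dominated convergence (\<open>profile_integral_tendsto\<close>) then yields the claim, where \<open>c powr p\<close> is
  the integral of \<open>f powr p\<close>.  That integral is positive since \<open>f > 0\<close> on \<open>(0, 1)\<close>.
\<close>

section \<open>Partial sums of powers\<close>

definition power_sum :: "real \<Rightarrow> nat \<Rightarrow> real" where
  "power_sum d m = (\<Sum>l=1..m. real l powr (- d))"

text \<open>
  The mean value theorem for \<open>x powr (1 - d) / (1 - d)\<close>, whose derivative \<open>x powr (- d)\<close> is
  decreasing.  Telescoping these two inequalities gives the bounds on \<open>power_sum\<close>.
\<close>

lemma powr_increment: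
  fixes d x :: real
  assumes "x > 0" "0 < d" "d < 1"
  shows "(x + 1) powr (- d) \<le> ((x + 1) powr (1 - d) - x powr (1 - d)) / (1 - d)"
    and "((x + 1) powr (1 - d) - x powr (1 - d)) / (1 - d) \<le> x powr (- d)"
proof -
  have "\<exists>z. z > x \<and> z < x + 1 \<and>
      (x + 1) powr (1 - d) / (1 - d) - x powr (1 - d) / (1 - d) = (x + 1 - x) * z powr (- d)"
    by (rule MVT2) (use assms in \<open>auto intro!: derivative_eq_intros\<close>)
  then obtain z where z: "z > x" "z < x + 1"
    and eq: "((x + 1) powr (1 - d) - x powr (1 - d)) / (1 - d) = z powr (- d)"
    by (auto simp: diff_divide_distrib)
  show "(x + 1) powr (- d) \<le> ((x + 1) powr (1 - d) - x powr (1 - d)) / (1 - d)"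
    unfolding eq using assms z by (intro powr_mono2') auto
  show "((x + 1) powr (1 - d) - x powr (1 - d)) / (1 - d) \<le> x powr (- d)"
    unfolding eq using assms z by (intro powr_mono2') auto
qed

lemma power_sum_0 [simp]: "power_sum d 0 = 0"
  and power_sum_Suc: "power_sum d (Suc m) = power_sum d m + real (Suc m) powr (- d)"
  by (simp_all add: power_sum_def)

lemma power_sum_upper:
  assumes "0 < d" "d < 1"
  shows "power_sum d m \<le> real m powr (1 - d) / (1 - d)"
proof (induction m)
  case (Suc m)
  have "real (Suc m) powr (- d) \<le> (real (Suc m) powr (1 - d) - real m powr (1 - d)) / (1 - d)"
  proof (cases "m = 0")
    case False
    then show ?thesis using powr_increment(1)[of "real m" d] assms by (simp add: add.commute)
  qed (use assms in \<open>simp add: field_simps\<close>)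
  with Suc show ?case unfolding power_sum_Suc diff_divide_distrib by linarith
qed auto

lemma power_sum_lower:
  assumes "0 < d" "d < 1"
  shows "(real (Suc m) powr (1 - d) - 1) / (1 - d) \<le> power_sum d m"
proof (induction m)
  case (Suc m)
  have "(real (Suc (Suc m)) powr (1 - d) - real (Suc m) powr (1 - d)) / (1 - d) \<le> real (Suc m) powr (- d)"
    using powr_increment(2)[of "real (Suc m)" d] assms by (simp add: add.commute)
  with Suc show ?case unfolding power_sum_Suc diff_divide_distrib by linarith
qed auto

lemma power_sum_mono: "k \<le> m \<Longrightarrow> power_sum d k \<le> power_sum d m"
  unfolding power_sum_def by (rule sum_mono2) auto

text \<open>
  Every term of the window is at most the term that precedes it.  This controls the tail in the
  dominated convergence argument, where a bound on each of the two partial sums would miss the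
  cancellation between them.
\<close>

lemma power_sum_window:
  assumes "0 < d" "k > 0"
  shows "power_sum d (k + n) - power_sum d k \<le> real n * real k powr (- d)"
proof (induction n)
  case (Suc n)
  have "real (Suc (k + n)) powr (- d) \<le> real k powr (- d)"
    using assms by (intro powr_mono2') auto
  with Suc show ?case by (simp add: power_sum_Suc algebra_simps)
qed auto

lemma power_sum_asymp:
  assumes "0 < d" "d < 1"
  shows "(\<lambda>m. power_sum d m / real m powr (1 - d)) \<longlonglongrightarrow> 1 / (1 - d)"
proof (rule tendsto_sandwich)
  have "(\<lambda>m. real m powr (- (1 - d))) \<longlonglongrightarrow> 0"
    using assms by (intro tendsto_neg_powr filterlim_real_sequentially) auto
  then have "(\<lambda>m. 1 / (1 - d) - real m powr (- (1 - d)) / (1 - d)) \<longlonglongrightarrow> 1 / (1 - d) - 0 / (1 - d)"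
    by (intro tendsto_intros) (use assms in auto)
  then show "(\<lambda>m. 1 / (1 - d) - real m powr (- (1 - d)) / (1 - d)) \<longlonglongrightarrow> 1 / (1 - d)"
    by simp
  show "\<forall>\<^sub>F m in sequentially. 1 / (1 - d) - real m powr (- (1 - d)) / (1 - d) \<le> power_sum d m / real m powr (1 - d)"
    using eventually_gt_at_top[of 0]
  proof eventually_elim
    case (elim m)
    have "real m powr (1 - d) \<le> real (Suc m) powr (1 - d)"
      using assms by (intro powr_mono2) auto
    then have "(real m powr (1 - d) - 1) / (1 - d) \<le> (real (Suc m) powr (1 - d) - 1) / (1 - d)"
      using assms by (intro divide_right_mono) auto
    also note power_sum_lower[OF assms, of m]
    finally have "(real m powr (1 - d) - 1) / (1 - d) / real m powr (1 - d) \<le> power_sum d m / real m powr (1 - d)"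
      by (rule divide_right_mono) auto
    moreover have "(real m powr (1 - d) - 1) / (1 - d) / real m powr (1 - d)
       = 1 / (1 - d) - real m powr (- (1 - d)) / (1 - d)"
      unfolding powr_minus[of "real m" "1 - d"] using elim
      by (simp add: diff_divide_distrib divide_inverse algebra_simps)
    ultimately show ?case by simp
  qed
  show "\<forall>\<^sub>F m in sequentially. power_sum d m / real m powr (1 - d) \<le> 1 / (1 - d)"
    using eventually_gt_at_top[of 0]
  proof eventually_elim
    case (elim m)
    then show ?case using power_sum_upper[OF assms, of m] assms by (simp add: field_simps)
  qed
qed auto

lemma nat_ceiling_scaled:
  assumes "x > 0"
  shows "filterlim (\<lambda>n. nat \<lceil>real n * x\<rceil>) at_top sequentially"
    and "(\<lambda>n. real (nat \<lceil>real n * x\<rceil>) / real n) \<longlonglongrightarrow> x"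
proof -
  have nx: "filterlim (\<lambda>n. real n * x) at_top sequentially"
    using assms by (intro filterlim_at_top_mult_tendsto_pos[OF tendsto_const] filterlim_real_sequentially)
  have "filterlim (\<lambda>n. real (nat \<lceil>real n * x\<rceil>)) at_top sequentially"
    by (rule filterlim_at_top_mono[OF nx]) (auto intro!: always_eventually of_nat_ceiling)
  then show "filterlim (\<lambda>n. nat \<lceil>real n * x\<rceil>) at_top sequentially"
    by (simp add: filterlim_sequentially_iff_filterlim_real)
  show "(\<lambda>n. real (nat \<lceil>real n * x\<rceil>) / real n) \<longlonglongrightarrow> x"
  proof (rule tendsto_sandwich)
    show "\<forall>\<^sub>F n in sequentially. x \<le> real (nat \<lceil>real n * x\<rceil>) / real n"
      using eventually_gt_at_top[of 0]
    proof eventually_elim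
      case (elim n)
      have "real n * x \<le> real (nat \<lceil>real n * x\<rceil>)" by (rule of_nat_ceiling)
      then show ?case using elim by (simp add: field_simps)
    qed
    show "\<forall>\<^sub>F n in sequentially. real (nat \<lceil>real n * x\<rceil>) / real n \<le> x + 1 / real n"
      using eventually_gt_at_top[of 0]
    proof eventually_elim
      case (elim n)
      have "0 \<le> real n * x" using assms by simp
      then have "real (nat \<lceil>real n * x\<rceil>) \<le> real n * x + 1" by linarith
      then show ?case using elim by (simp add: field_simps)
    qed
    have "(\<lambda>n. x + 1 / real n) \<longlonglongrightarrow> x + 0" by (intro tendsto_intros lim_1_over_n)
    then show "(\<lambda>n. x + 1 / real n) \<longlonglongrightarrow> x" by simp
  qed auto
qed

text \<open>
  All of \<open>\<real>\<close> is admitted for \<open>x\<close>: for \<open>x \<le> 0\<close> both sides vanish, by truncation of the ceiling on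
  the left and by \<open>0 powr (1 - d) = 0\<close> on the right.  So the lemma also covers the shifted
  argument \<open>x - 1\<close> in the profile.
\<close>

lemma power_sum_scaled:
  assumes "0 < d" "d < 1"
  shows "(\<lambda>n. power_sum d (nat \<lceil>real n * x\<rceil>) / real n powr (1 - d)) \<longlonglongrightarrow> max x 0 powr (1 - d) / (1 - d)"
proof (cases "x > 0")
  case True
  have "(\<lambda>n. power_sum d (nat \<lceil>real n * x\<rceil>) / real (nat \<lceil>real n * x\<rceil>) powr (1 - d)
        * (real (nat \<lceil>real n * x\<rceil>) / real n) powr (1 - d)) \<longlonglongrightarrow> 1 / (1 - d) * x powr (1 - d)"
    using True
    by (intro tendsto_intros filterlim_compose[OF power_sum_asymp[OF assms]] nat_ceiling_scaled) auto
  moreover have "\<forall>\<^sub>F n in sequentially. power_sum d (nat \<lceil>real n * x\<rceil>) / real (nat \<lceil>real n * x\<rceil>) powr (1 - d)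
        * (real (nat \<lceil>real n * x\<rceil>) / real n) powr (1 - d) = power_sum d (nat \<lceil>real n * x\<rceil>) / real n powr (1 - d)"
    using eventually_gt_at_top[of 0]
  proof eventually_elim
    case (elim n)
    then have "\<lceil>real n * x\<rceil> > 0" using True by simp
    then show ?case using elim by (simp add: powr_divide)
  qed
  ultimately have "(\<lambda>n. power_sum d (nat \<lceil>real n * x\<rceil>) / real n powr (1 - d)) \<longlonglongrightarrow> 1 / (1 - d) * x powr (1 - d)"
    by (rule Lim_transform_eventually)
  then show ?thesis using True by (simp add: max_def)
next
  case False
  then have "nat \<lceil>real n * x\<rceil> = 0" for n
    by (simp add: mult_nonneg_nonpos)
  with False show ?thesis by (simp add: max_def)
qed

section \<open>Sums as integrals of step functions\<close>

text \<open>
  The step function takes the value \<open>g (Suc i)\<close> on an interval of length \<open>1 / n\<close>, and the value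
  \<open>g 0\<close> on the whole negative half-line, which is why that value has to vanish.
\<close>

lemma nn_integral_step:
  fixes g :: "nat \<Rightarrow> real"
  assumes g: "g 0 = 0" "\<And>i. g i \<ge> 0" and n: "n > 0"
  shows "(\<integral>\<^sup>+x. ennreal (g (nat \<lceil>real n * x\<rceil>)) \<partial>lborel) = (\<Sum>i. ennreal (g (Suc i) / real n))"
proof -
  define I where "I i = {real i / real n<..real (Suc i) / real n}" for i
  have I: "x \<in> I i \<longleftrightarrow> nat \<lceil>real n * x\<rceil> = Suc i" for x i
  proof -
    have "x \<in> I i \<longleftrightarrow> real i < real n * x \<and> real n * x \<le> real i + 1"
      using n by (auto simp: I_def field_simps)
    also have "\<dots> \<longleftrightarrow> \<lceil>real n * x\<rceil> = int (Suc i)"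
      by (simp add: ceiling_eq_iff add.commute)
    also have "\<dots> \<longleftrightarrow> nat \<lceil>real n * x\<rceil> = Suc i" by auto
    finally show ?thesis .
  qed
  have "ennreal (g (nat \<lceil>real n * x\<rceil>)) = (\<Sum>i. ennreal (g (Suc i)) * indicator (I i) x)" for x
  proof (cases "nat \<lceil>real n * x\<rceil>")
    case 0
    then show ?thesis by (simp add: I indicator_def g)
  next
    case (Suc k)
    have "(\<Sum>i. ennreal (g (Suc i)) * indicator (I i) x) = (\<Sum>i\<in>{k}. ennreal (g (Suc i)) * indicator (I i) x)"
      by (rule suminf_finite) (auto simp: I Suc)
    then show ?thesis by (simp add: I Suc)
  qed
  then have "(\<integral>\<^sup>+x. ennreal (g (nat \<lceil>real n * x\<rceil>)) \<partial>lborel)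
      = (\<integral>\<^sup>+x. (\<Sum>i. ennreal (g (Suc i)) * indicator (I i) x) \<partial>lborel)" by simp
  also have "\<dots> = (\<Sum>i. \<integral>\<^sup>+x. ennreal (g (Suc i)) * indicator (I i) x \<partial>lborel)"
    by (rule nn_integral_suminf) (auto simp: I_def)
  also have "\<dots> = (\<Sum>i. ennreal (g (Suc i) / real n))"
  proof (rule suminf_cong)
    fix i
    have "emeasure lborel (I i) = ennreal (1 / real n)"
      unfolding I_def using n by (subst emeasure_lborel_Ioc) (auto simp: field_simps)
    then show "(\<integral>\<^sup>+x. ennreal (g (Suc i)) * indicator (I i) x \<partial>lborel) = ennreal (g (Suc i) / real n)"
      by (subst nn_integral_cmult_indicator) (auto simp: I_def g ennreal_mult[symmetric])
  qed
  finally show ?thesis .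
qed

text \<open>
  For nonnegative terms, integrability of the step function is equivalent to summability.  So an
  integrable pointwise bound on the step function also ensures that the infinite sum in \<open>W\<close> is
  not a default value.
\<close>

lemma integral_step_sums:
  fixes g :: "nat \<Rightarrow> real"
  assumes g: "g 0 = 0" "\<And>i. g i \<ge> 0" and n: "n > 0"
    and int: "integrable lborel (\<lambda>x. g (nat \<lceil>real n * x\<rceil>))"
  shows "((\<lambda>i. g (Suc i)) has_sum (real n * (\<integral>x. g (nat \<lceil>real n * x\<rceil>) \<partial>lborel))) UNIV"
proof -
  let ?J = "\<integral>x. g (nat \<lceil>real n * x\<rceil>) \<partial>lborel"
  have "(\<Sum>i. ennreal (g (Suc i) / real n)) = (\<integral>\<^sup>+x. ennreal (g (nat \<lceil>real n * x\<rceil>)) \<partial>lborel)"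
    by (rule nn_integral_step[symmetric]) (use g n in auto)
  also have "\<dots> = ennreal ?J"
    by (rule nn_integral_eq_integral[OF int]) (use g in auto)
  finally have "(\<lambda>i. ennreal (g (Suc i) / real n)) sums ennreal ?J"
    using summable_sums[OF summableI, of "\<lambda>i. ennreal (g (Suc i) / real n)"] by simp
  moreover have "?J \<ge> 0" using g by (intro Bochner_Integration.integral_nonneg) auto
  ultimately have "(\<lambda>i. g (Suc i) / real n) sums ?J"
    using g by (subst (asm) sums_ennreal) auto
  then have "(\<lambda>i. real n * (g (Suc i) / real n)) sums (real n * ?J)"
    by (rule sums_mult)
  then have "(\<lambda>i. g (Suc i)) sums (real n * ?J)"
    using n by simp
  then show ?thesis by (rule sums_nonneg_imp_has_sum) (use g in auto)
qed

lemma filterlim_at_top_diff_const: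
  "filterlim (\<lambda>x::real. x - c) at_top at_top"
  using filterlim_tendsto_add_at_top[OF tendsto_const[of "- c"] filterlim_ident] by simp

lemma powr_tail_integrable:
  fixes q :: real
  assumes "q > 1"
  shows "integrable lborel (\<lambda>x. (x - 1) powr (- q) * indicator {2..} x)"
proof (rule integrableI_nonneg)
  have "(\<integral>\<^sup>+x. ennreal ((x - 1) powr (- q)) * indicator {2..} x \<partial>lborel)
      = ennreal (0 - (2 - 1) powr (1 - q) / (1 - q))"
  proof (rule nn_integral_FTC_atLeast)
    have "((\<lambda>x::real. (x - 1) powr (- (q - 1)) / (1 - q)) \<longlongrightarrow> 0 / (1 - q)) at_top"
      using assms
      by (intro tendsto_intros tendsto_neg_powr filterlim_at_top_diff_const) auto
    then show "((\<lambda>x::real. (x - 1) powr (1 - q) / (1 - q)) \<longlongrightarrow> 0) at_top" by simp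
  qed (use assms in \<open>auto intro!: derivative_eq_intros\<close>)
  then show "(\<integral>\<^sup>+x. ennreal ((x - 1) powr (- q) * indicator {2..} x) \<partial>lborel) < \<infinity>"
    by (simp add: ennreal_mult' ennreal_indicator[symmetric] mult.commute)
qed auto

section \<open>The rescaled windows and their limit\<close>

text \<open>
  The truncated subtraction encodes windows that start before the first term.  Truncation of the
  ceiling makes the profile vanish on the negative half-line, so that integrals can extend over
  all of \<open>\<real>\<close>.
\<close>

definition profile :: "real \<Rightarrow> nat \<Rightarrow> real \<Rightarrow> real" where
  "profile d n x = (power_sum d (nat \<lceil>real n * x\<rceil>) - power_sum d (nat \<lceil>real n * x\<rceil> - n)) / real n powr (1 - d)"

definition limit_profile :: "real \<Rightarrow> real \<Rightarrow> real" where
  "limit_profile d x = (max x 0 powr (1 - d) - max (x - 1) 0 powr (1 - d)) / (1 - d)"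

lemma profile_nonneg: "profile d n x \<ge> 0"
  unfolding profile_def by (simp add: power_sum_mono)

lemma profile_tendsto:
  assumes "0 < d" "d < 1"
  shows "(\<lambda>n. profile d n x) \<longlonglongrightarrow> limit_profile d x"
proof -
  \<comment> \<open>Shifting the window by \<open>n\<close> terms is the shift \<open>x - 1\<close> of the argument, so the two
    partial sums converge separately.\<close>
  have "nat \<lceil>real n * x\<rceil> - n = nat \<lceil>real n * (x - 1)\<rceil>" for n
  proof -
    have "\<lceil>real n * (x - 1)\<rceil> = \<lceil>real n * x - of_int (int n)\<rceil>" by (simp add: algebra_simps)
    also have "\<dots> = \<lceil>real n * x\<rceil> - int n" by (rule ceiling_diff_of_int)
    finally show ?thesis by simp
  qed
  then have "profile d n x = power_sum d (nat \<lceil>real n * x\<rceil>) / real n powr (1 - d)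
      - power_sum d (nat \<lceil>real n * (x - 1)\<rceil>) / real n powr (1 - d)" for n
    by (simp add: profile_def diff_divide_distrib)
  then show ?thesis
    unfolding limit_profile_def diff_divide_distrib by (auto intro!: tendsto_diff power_sum_scaled assms)
qed

definition profile_bound :: "real \<Rightarrow> real \<Rightarrow> real \<Rightarrow> real" where
  "profile_bound p d x = (2 powr (1 - d) / (1 - d)) powr p * indicator {0<..<2} x
     + (x - 1) powr (- (d * p)) * indicator {2..} x"

text \<open>
  For \<open>x < 2\<close> the window contains only terms up to index \<open>2 n\<close>; for \<open>x \<ge> 2\<close> it starts beyond index
  \<open>n (x - 1) \<ge> n\<close>, away from the singularity of \<open>(x - 1) powr (- d)\<close> at 1.
\<close>

lemma profile_le_bound:
  assumes "0 < d" "d < 1" "p > 0" "n > 0"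
  shows "profile d n x powr p \<le> profile_bound p d x"
proof -
  let ?m = "nat \<lceil>real n * x\<rceil>"
  consider "x \<le> 0" | "0 < x" "x < 2" | "x \<ge> 2" by linarith
  then show ?thesis
  proof cases
    case 1
    then have "?m = 0" by (simp add: mult_nonneg_nonpos)
    with 1 show ?thesis by (simp add: profile_def profile_bound_def)
  next
    case 2
    have "real n * x \<le> real (2 * n)" using 2 assms by simp
    then have "?m \<le> 2 * n" by linarith
    then have "power_sum d ?m \<le> real (2 * n) powr (1 - d) / (1 - d)"
      using power_sum_mono[of ?m "2 * n" d] power_sum_upper[of d "2 * n"] assms by linarith
    moreover have "power_sum d (?m - n) \<ge> 0" using power_sum_mono[of 0 "?m - n" d] by simp
    ultimately have "profile d n x \<le> real (2 * n) powr (1 - d) / (1 - d) / real n powr (1 - d)"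
      unfolding profile_def by (intro divide_right_mono) auto
    also have "\<dots> = 2 powr (1 - d) / (1 - d)"
      using assms by (simp add: powr_mult)
    finally have "profile d n x powr p \<le> (2 powr (1 - d) / (1 - d)) powr p"
      using assms by (intro powr_mono2 profile_nonneg) auto
    with 2 show ?thesis by (simp add: profile_bound_def)
  next
    case 3
    have mx: "real n * x \<le> real ?m" by (rule of_nat_ceiling)
    have "real n * 2 \<le> real n * x" using 3 by (intro mult_left_mono) auto
    with mx have m2: "?m \<ge> 2 * n" by linarith
    have pos: "real n * (x - 1) > 0" using 3 assms by simp
    have le: "real n * (x - 1) \<le> real (?m - n)" using mx m2 by (simp add: of_nat_diff algebra_simps)
    have "power_sum d ?m - power_sum d (?m - n) \<le> real n * real (?m - n) powr (- d)"
      using power_sum_window[of d "?m - n" n] m2 assms by simp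
    also have "\<dots> \<le> real n * (real n * (x - 1)) powr (- d)"
      using assms le pos by (intro mult_left_mono powr_mono2') auto
    also have "\<dots> = real n powr (1 - d) * (x - 1) powr (- d)"
      unfolding powr_mult using assms by (simp add: powr_diff powr_minus divide_inverse)
    finally have "profile d n x \<le> (x - 1) powr (- d)"
      using assms by (simp add: profile_def field_simps)
    then have "profile d n x powr p \<le> ((x - 1) powr (- d)) powr p"
      using assms by (intro powr_mono2 profile_nonneg) auto
    with 3 show ?thesis by (simp add: profile_bound_def powr_powr)
  qed
qed

lemma profile_bound_integrable:
  assumes "d * p > 1"
  shows "integrable lborel (profile_bound p d)"
  unfolding profile_bound_def
  by (intro Bochner_Integration.integrable_add integrable_mult_right powr_tail_integrable assms
       integrable_real_indicator) auto

lemma profile_measurable [measurable]: "profile d n \<in> borel_measurable borel"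
  unfolding profile_def by measurable

lemma limit_profile_measurable [measurable]: "limit_profile d \<in> borel_measurable borel"
  unfolding limit_profile_def by measurable

lemma profile_integral_tendsto:
  assumes "0 < d" "d < 1" "p > 0" "d * p > 1"
  shows "integrable lborel (\<lambda>x. limit_profile d x powr p)"
    and "(\<lambda>n. \<integral>x. profile d n x powr p \<partial>lborel) \<longlonglongrightarrow> (\<integral>x. limit_profile d x powr p \<partial>lborel)"
    and "n > 0 \<Longrightarrow> integrable lborel (\<lambda>x. profile d n x powr p)"
proof -
  have "(\<lambda>n. profile d (Suc n) x powr p) \<longlonglongrightarrow> limit_profile d x powr p" for x
    by (rule tendsto_powr'[OF LIMSEQ_Suc[OF profile_tendsto[OF assms(1,2)]] tendsto_const])
      (use assms(3) in \<open>simp add: profile_nonneg\<close>)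
  then have lim: "AE x in lborel. (\<lambda>n. profile d (Suc n) x powr p) \<longlonglongrightarrow> limit_profile d x powr p"
    by simp
  have bound: "AE x in lborel. norm (profile d (Suc n) x powr p) \<le> profile_bound p d x" for n
    using profile_le_bound[OF assms(1-3), of "Suc n"] by simp
  note dct = _ _ profile_bound_integrable[OF assms(4)] lim bound
  show "integrable lborel (\<lambda>x. limit_profile d x powr p)"
    by (rule integrable_dominated_convergence[OF dct]) auto
  have "(\<lambda>n. \<integral>x. profile d (Suc n) x powr p \<partial>lborel) \<longlonglongrightarrow> (\<integral>x. limit_profile d x powr p \<partial>lborel)"
    by (rule integral_dominated_convergence[OF dct]) auto
  then show "(\<lambda>n. \<integral>x. profile d n x powr p \<partial>lborel) \<longlonglongrightarrow> (\<integral>x. limit_profile d x powr p \<partial>lborel)"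
    by (rule LIMSEQ_imp_Suc)
  show "n > 0 \<Longrightarrow> integrable lborel (\<lambda>x. profile d n x powr p)"
    using integrable_dominated_convergence2[OF dct, of "n - 1"] by simp
qed

text \<open>
  The limit profile equals \<open>x powr (1 - d) / (1 - d)\<close> on \<open>(0, 1)\<close>, a set of positive measure, so
  its \<open>p\<close>-th power does not vanish almost everywhere.
\<close>

lemma limit_profile_integral_pos:
  assumes "0 < d" "d < 1" "integrable lborel (\<lambda>x. limit_profile d x powr p)"
  shows "(\<integral>x. limit_profile d x powr p \<partial>lborel) > 0"
proof -
  have "(\<integral>x. limit_profile d x powr p \<partial>lborel) \<noteq> 0"
  proof
    assume "(\<integral>x. limit_profile d x powr p \<partial>lborel) = 0"
    then have "AE x in lborel. limit_profile d x powr p = 0"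
      using integral_nonneg_eq_0_iff_AE[OF assms(3)] by simp
    then have "AE x in lborel. x \<notin> {0<..<1::real}"
    proof eventually_elim
      case (elim x)
      then show ?case using assms by (auto simp: limit_profile_def max_def split: if_splits)
    qed
    then have "emeasure lborel {0<..<1::real} = 0"
      by (subst (asm) AE_iff_measurable[of "{0<..<1}"]) auto
    then show False by simp
  qed
  moreover have "(\<integral>x. limit_profile d x powr p \<partial>lborel) \<ge> 0" by simp
  ultimately show ?thesis by linarith
qed

section \<open>The asymptotics of \<open>W\<close>\<close>

lemma w_eq_power_sum_diff:
  assumes "\<And>j. j \<ge> 0 \<Longrightarrow> \<psi> j = (real_of_int j + 1) powr (- d)"
    and "\<And>j. j < 0 \<Longrightarrow> \<psi> j = 0"
  shows "w \<psi> n (int n - int i) = power_sum d (Suc i) - power_sum d (Suc i - n)"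
proof -
  \<comment> \<open>Over all integers \<open>\<psi>\<close> is the difference sequence of \<open>power_sum\<close> extended by 0, so the sum
    defining \<open>w\<close> telescopes.\<close>
  have psi: "\<psi> z = power_sum d (nat (z + 1)) - power_sum d (nat z)" for z
  proof (cases "z \<ge> 0")
    case True
    then have "nat (z + 1) = Suc (nat z)" by simp
    with True show ?thesis by (simp add: assms(1) power_sum_Suc add.commute)
  qed (simp add: assms(2))
  have "(\<Sum>k=1..N. \<psi> (int k - j)) = power_sum d (nat (int N + 1 - j)) - power_sum d (nat (1 - j))" for N j
    by (induction N) (auto simp: psi algebra_simps)
  from this[where N = n and j = "int n - int i"] show ?thesis
    by (simp add: w_def nat_diff_distrib' algebra_simps nat_add_distrib Suc_nat_eq_nat_zadd1)
qed

text \<open>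
  An exact identity, not only an asymptotic one: the exponent \<open>1 / p + 1 - d\<close> of the growth comes
  from the mesh \<open>1 / n\<close> of the step function and the scale \<open>n powr (1 - d)\<close> of the windows.
\<close>

lemma W_eq_integral:
  assumes "0 < d" "d < 1" "p > 0" "d * p > 1" and n: "n > 0"
    and "\<And>j. j \<ge> 0 \<Longrightarrow> \<psi> j = (real_of_int j + 1) powr (- d)"
    and "\<And>j. j < 0 \<Longrightarrow> \<psi> j = 0"
  shows "W \<psi> p n = (\<integral>x. profile d n x powr p \<partial>lborel) powr (1 / p) * real n powr (1 / p + 1 - d)"
proof -
  define g where "g m = ((power_sum d m - power_sum d (m - n)) / real n powr (1 - d)) powr p" for m
  have profile: "profile d n x powr p = g (nat \<lceil>real n * x\<rceil>)" for x by (simp add: profile_def g_def)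
  let ?I = "\<integral>x. profile d n x powr p \<partial>lborel"
  have "((\<lambda>i. g (Suc i)) has_sum (real n * ?I)) UNIV"
    unfolding profile
    by (rule integral_step_sums)
      (use profile_integral_tendsto(3)[OF assms(1-5)] n in \<open>auto simp: g_def profile\<close>)
  then have "((\<lambda>i. real n powr (p * (1 - d)) * g (Suc i)) has_sum (real n powr (p * (1 - d)) * (real n * ?I))) UNIV"
    by (rule has_sum_cmult_right)
  moreover have "real n powr (p * (1 - d)) * g (Suc i) = \<bar>w \<psi> n (int n - int i)\<bar> powr p" for i
  proof -
    have "power_sum d (Suc i) - power_sum d (Suc i - n) \<ge> 0" by (simp add: power_sum_mono)
    moreover have "w \<psi> n (int n - int i) = power_sum d (Suc i) - power_sum d (Suc i - n)"
      by (rule w_eq_power_sum_diff) (use assms in auto)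
    ultimately show ?thesis
      using n by (simp add: g_def powr_divide powr_powr mult.commute)
  qed
  ultimately have "((\<lambda>i. \<bar>w \<psi> n (int n - int i)\<bar> powr p) has_sum (real n powr (p * (1 - d)) * (real n * ?I))) UNIV"
    by simp
  moreover have bij: "bij_betw (\<lambda>i. int n - int i) UNIV {..int n}"
    by (rule bij_betwI[of _ _ _ "\<lambda>j. nat (int n - j)"]) auto
  ultimately have "((\<lambda>j. \<bar>w \<psi> n j\<bar> powr p) has_sum (real n powr (p * (1 - d)) * (real n * ?I))) {..int n}"
    using has_sum_reindex_bij_betw[OF bij, of "\<lambda>j. \<bar>w \<psi> n j\<bar> powr p"] by simp
  then have "W \<psi> p n = (real n powr (p * (1 - d)) * (real n * ?I)) powr (1 / p)"
    unfolding W_def by (simp add: infsumI)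
  also have "real n powr (p * (1 - d)) * (real n * ?I) = ?I * real n powr (p * (1 - d) + 1)"
    using n by (simp add: powr_add)
  also have "(?I * real n powr (p * (1 - d) + 1)) powr (1 / p) = ?I powr (1 / p) * real n powr ((p * (1 - d) + 1) / p)"
    by (simp add: powr_mult powr_powr)
  also have "(p * (1 - d) + 1) / p = 1 / p + 1 - d" using assms(3) by (simp add: field_simps)
  finally show ?thesis .
qed

theorem proposition5:
  fixes p d :: real and \<psi> :: "int \<Rightarrow> real"
  assumes "p > 1"
    and "1 / p < d" and "d < 1"
    and "\<And>j. j \<ge> 0 \<Longrightarrow> \<psi> j = (real_of_int j + 1) powr (- d)"
    and "\<And>j. j < 0 \<Longrightarrow> \<psi> j = 0"
  shows "\<exists>c::real. c > 0 \<and> W \<psi> p \<sim>[at_top] (\<lambda>n. c * real n powr (1 / p + 1 - d))"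
proof -
  have p: "p > 0" using assms by simp
  have "0 < 1 / p" using p by simp
  then have d: "0 < d" using assms by linarith
  have dp: "d * p > 1" using assms p by (simp add: field_simps)
  define C where "C = (\<integral>x. limit_profile d x powr p \<partial>lborel)"
  define I where "I n = (\<integral>x. profile d n x powr p \<partial>lborel)" for n
  have "C > 0" unfolding C_def
    by (intro limit_profile_integral_pos profile_integral_tendsto(1) d dp p assms(3))
  have "I \<longlonglongrightarrow> C" unfolding C_def I_def
    by (intro profile_integral_tendsto(2) d dp p assms(3))
  then have "(\<lambda>n. I n powr (1 / p)) \<longlonglongrightarrow> C powr (1 / p)"
    using \<open>C > 0\<close> by (intro tendsto_powr tendsto_const) auto
  then have lim: "(\<lambda>n. I n powr (1 / p)) \<sim>[at_top] (\<lambda>_. C powr (1 / p))"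
    using \<open>C > 0\<close> by (simp add: tendsto_imp_asymp_equiv_const)
  have "\<forall>\<^sub>F n in at_top. W \<psi> p n = I n powr (1 / p) * real n powr (1 / p + 1 - d)"
    using eventually_gt_at_top[of 0]
    by eventually_elim (simp add: I_def W_eq_integral[OF d assms(3) p dp _ assms(4,5)])
  then have "W \<psi> p \<sim>[at_top] (\<lambda>n. I n powr (1 / p) * real n powr (1 / p + 1 - d))"
    by (rule asymp_equiv_refl_ev)
  also have "\<dots> \<sim>[at_top] (\<lambda>n. C powr (1 / p) * real n powr (1 / p + 1 - d))"
    by (intro asymp_equiv_intros lim)
  finally show ?thesis using \<open>C > 0\<close> by (intro exI[of _ "C powr (1 / p)"]) auto
qed

end
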